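(* Let $\tilde{f} : \mathbb{R}^d \times \mathbb{R}^d \times [0,\infty) \to \mathbb{R}^d$ be a consistent approximation of $f$ and, for each $m = 1,\dots,M$, let $\tilde{i}_m : \mathbb{R}^d \times \mathbb{R}^d \times [0,\infty) \to \mathbb{R}^d$ be a consistent approximation of $i_m$ and let $\bar{i}_m$ be an arbitrary discrete gradient of $I_m$. Define $$P := \mathrm{Id} - A (B^T A)^{-1} B^T, \qquad A := [\tilde{i}_1 \cdots \tilde{i}_M] \in \mathbb{R}^{d \times M}, \qquad B := [\bar{i}_1 \cdots \bar{i}_M] \in \mathbb{R}^{d \times M},$$ where $\tilde{i}_m = \tilde{i}_m(x,x',h)$ and $\bar{i}_m = \bar{i}_m(x,x')$ (so $P, A, B$ depend on $(x,x',h)$). Consider, for given $x \in \mathbb{R}^d$ and $h \in [0,\infty)$, the two methods (a) find $x' \in \mathbb{R}^d$ and $\lambda \in \mathbb{R}^M$ such that $x' = x + h \tilde{f}(x,x',h) + A\lambda$ and $I_m(x') = I_m(x)$ for all $m = 1,\dots,M$; (b) find $x' \in \mathbb{R}^d$ such that $x' = x + h P \tilde{f}(x,x',h)$. Assume that, for sufficiently small $h$, 1. each of the two methods has a uniquely defined solution ($(x',\lambda) \in \mathbb{R}^d \times \mathbb{R}^M$ in (a), $x' \in \mathbb{R}^d$ in (b)); and that, at the solutions $x'$ of both methods, 2. $\{\tilde{i}_1,\dots,\tilde{i}_M\}$ and $\{\bar{i}_1,\dots,\bar{i}_M\}$ are linearly independent sets; 3. $\tilde{\mathcal{S}}$ and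 $\bar{\mathcal{S}}^\perp$ are complementary subspaces of $\mathbb{R}^d$, where $\tilde{\mathcal{S}} = \operatorname{span}\{\tilde{i}_1,\dots,\tilde{i}_M\}$ and $\bar{\mathcal{S}} = \operatorname{span}\{\bar{i}_1,\dots,\bar{i}_M\}$ (i.e. $\tilde{\mathcal{S}} + \bar{\mathcal{S}}^\perp = \mathbb{R}^d$ and $\tilde{\mathcal{S}} \cap \bar{\mathcal{S}}^\perp = \{0\}$). Then (a) and (b) describe the same linear projection method, i.e. for such $x$ and $h$ they yield the same $x'$.
   Context: Setting: $d, M \in \mathbb{N}$; $f : \mathbb{R}^d \to \mathbb{R}^d$ is locally Lipschitz continuous; the ODE $\dot{x} = f(x)$ has $M$ first integrals $I_1,\dots,I_M : \mathbb{R}^d \to \mathbb{R}$ (each constant along solutions), and $i_m := \nabla I_m$. A discrete gradient of $I_m$ is a continuous map $\bar{i}_m : \mathbb{R}^d \times \mathbb{R}^d \to \mathbb{R}^d$ with $\bar{i}_m(x,x') \cdot (x'-x) = I_m(x') - I_m(x)$ and $\bar{i}_m(x,x) = i_m(x)$ for all $x,x' \in \mathbb{R}^d$. For $\varphi : \mathbb{R}^d \to \mathbb{R}^d$, a map $\tilde{\varphi} : \mathbb{R}^d \times \mathbb{R}^d \times [0,\infty) \to \mathbb{R}^d$ is a consistent approximation of $\varphi$ if $\tilde{\varphi}(x,x,0) = \varphi(x)$ for all $x \in \mathbb{R}^d$. $\mathrm{Id}$ is the $d \times d$ identity matrix; $\perp$ denotes the orthogonal complement for the Euclidean inner product. Under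 conditions 2 and 3 the matrix $B^T A$ is invertible, so $P$ is well defined. *)

theory Defs
  imports "HOL-Analysis.Analysis"
begin

text \<open>The index types \<open>'d\<close> and \<open>'m\<close> of class \<^class>\<open>finite\<close> stand for
  the index sets \<open>{1..d}\<close> and \<open>{1..M}\<close>. Maps on
  \<open>\<real>\<^sup>d \<times> \<real>\<^sup>d \<times> [0,\<infinity>)\<close> are curried and total in the last argument; their values at
  negative step sizes are irrelevant, since only \<open>h \<ge> 0\<close> is ever used.\<close>

definition first_integral :: "(real^'d \<Rightarrow> real^'d) \<Rightarrow> (real^'d \<Rightarrow> real) \<Rightarrow> bool" where
  "first_integral f I \<longleftrightarrow>
     (\<forall>(T::real set) u. is_interval T \<and>
        (\<forall>t\<in>T. (u has_vector_derivative f (u t)) (at t within T)) \<longrightarrow>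
        (\<lambda>t. I (u t)) constant_on T)"

definition discrete_gradient ::
  "(real^'d \<Rightarrow> real) \<Rightarrow> (real^'d \<Rightarrow> real^'d) \<Rightarrow> (real^'d \<Rightarrow> real^'d \<Rightarrow> real^'d) \<Rightarrow> bool" where
  "discrete_gradient I i ib \<longleftrightarrow>
     continuous_on UNIV (\<lambda>(x, x'). ib x x') \<and>
     (\<forall>x x'. ib x x' \<bullet> (x' - x) = I x' - I x) \<and>
     (\<forall>x. ib x x = i x)"

definition consistent_approximation ::
  "(real^'d \<Rightarrow> real^'d) \<Rightarrow> (real^'d \<Rightarrow> real^'d \<Rightarrow> real \<Rightarrow> real^'d) \<Rightarrow> bool" where
  "consistent_approximation \<phi> \<phi>t \<longleftrightarrow> (\<forall>x. \<phi>t x x 0 = \<phi> x)"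

definition matrix_of_columns :: "('m::finite \<Rightarrow> real^'d) \<Rightarrow> real^'m^'d" where
  "matrix_of_columns v = (\<chi> j m. v m $ j)"

definition projection_matrix :: "real^'m^'d \<Rightarrow> real^'m^'d \<Rightarrow> real^'d^'d" where
  "projection_matrix A B = mat 1 - A ** matrix_inv (transpose B ** A) ** transpose B"

definition solves_a ::
  "(real^'d \<Rightarrow> real^'d \<Rightarrow> real \<Rightarrow> real^'d) \<Rightarrow> ('m::finite \<Rightarrow> real^'d \<Rightarrow> real^'d \<Rightarrow> real \<Rightarrow> real^'d) \<Rightarrow>
   ('m \<Rightarrow> real^'d \<Rightarrow> real) \<Rightarrow> real^'d \<Rightarrow> real \<Rightarrow> real^'d \<Rightarrow> real^'m \<Rightarrow> bool" where
  "solves_a ft it I x h x' l \<longleftrightarrow>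
     x' = x + h *\<^sub>R ft x x' h + matrix_of_columns (\<lambda>m. it m x x' h) *v l \<and>
     (\<forall>m. I m x' = I m x)"

text \<open>\<^const>\<open>matrix_inv\<close> is an unspecified value on singular matrices, so invertibility of
  \<open>B\<^sup>T A\<close> is required explicitly: a point at which \<open>P\<close> is undefined is not a solution.\<close>

definition solves_b ::
  "(real^'d \<Rightarrow> real^'d \<Rightarrow> real \<Rightarrow> real^'d) \<Rightarrow> ('m::finite \<Rightarrow> real^'d \<Rightarrow> real^'d \<Rightarrow> real \<Rightarrow> real^'d) \<Rightarrow>
   ('m \<Rightarrow> real^'d \<Rightarrow> real^'d \<Rightarrow> real^'d) \<Rightarrow> real^'d \<Rightarrow> real \<Rightarrow> real^'d \<Rightarrow> bool" where
  "solves_b ft it ib x h x' \<longleftrightarrow>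
     (let A = matrix_of_columns (\<lambda>m. it m x x' h); B = matrix_of_columns (\<lambda>m. ib m x x') in
      invertible (transpose B ** A) \<and>
      x' = x + h *\<^sub>R (projection_matrix A B *v ft x x' h))"

text \<open>Independence of a family: a repeated vector makes it dependent, which
  \<open>independent (range v)\<close> alone would not detect.\<close>

definition independent_family :: "('m::finite \<Rightarrow> real^'d) \<Rightarrow> bool" where
  "independent_family v \<longleftrightarrow> inj v \<and> independent (range v)"

definition complementary_subspaces :: "(real^'d) set \<Rightarrow> (real^'d) set \<Rightarrow> bool" where
  "complementary_subspaces S T \<longleftrightarrow>
     subspace S \<and> subspace T \<and> {s + t |s t. s \<in> S \<and> t \<in> T} = UNIV \<and> S \<inter> T = {0}"

definition nondegenerate_at ::
  "('m::finite \<Rightarrow> real^'d \<Rightarrow> real^'d \<Rightarrow> real \<Rightarrow> real^'d) \<Rightarrow> ('m \<Rightarrow> real^'d \<Rightarrow> real^'d \<Rightarrow> real^'d) \<Rightarrow>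
   real^'d \<Rightarrow> real \<Rightarrow> real^'d \<Rightarrow> bool" where
  "nondegenerate_at it ib x h x' \<longleftrightarrow>
     independent_family (\<lambda>m. it m x x' h) \<and>
     independent_family (\<lambda>m. ib m x x') \<and>
     complementary_subspaces (span (range (\<lambda>m. it m x x' h)))
       (orthogonal_comp (span (range (\<lambda>m. ib m x x'))))"

end

theory Submission
  imports Defs
begin

text \<open>Since \<open>B\<^sup>T(x' - x)\<close> collects the differences \<open>I\<^sub>m(x') - I\<^sub>m(x)\<close>, conservation of
  the integrals means \<open>B\<^sup>T(x' - x) = 0\<close>. Applied to \<open>x' = x + h f + A\<lambda>\<close> this is the linear
  system \<open>B\<^sup>TA\<lambda> = -h B\<^sup>Tf\<close>, and its solution turns \<open>h f + A\<lambda>\<close> into \<open>h P f\<close>.\<close>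

lemma matrix_of_columns_mult_vec:
  "matrix_of_columns v *v l = (\<Sum>m\<in>UNIV. l $ m *\<^sub>R v m)"
  by (simp add: matrix_of_columns_def vec_eq_iff matrix_vector_mult_def mult.commute)

lemma transpose_matrix_of_columns_mult_vec:
  "(transpose (matrix_of_columns v) *v y) $ m = v m \<bullet> y"
  by (simp add: matrix_of_columns_def transpose_def matrix_vector_mult_def inner_vec_def)

text \<open>Injectivity of \<open>v\<close> turns a relation indexed by \<open>'m\<close> into one
  indexed by the set \<open>range v\<close>, where set independence kills every coefficient.\<close>

lemma independent_family_matrix_of_columns_eq_0:
  assumes "independent_family v" and "matrix_of_columns v *v l = 0"
  shows "l = 0"
proof -
  have inj: "inj v" and ind: "independent (range v)"
    using assms(1) by (auto simp: independent_family_def)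
  \<comment> \<open>As \<open>v\<close> is injective, \<open>inv v w\<close> is the only index
    carrying the vector \<open>w\<close>, so its coefficient is not a sum over several
    indices.\<close>
  have "(\<Sum>w\<in>range v. l $ (inv v w) *\<^sub>R w) = 0"
    using assms(2) inj by (simp add: matrix_of_columns_mult_vec sum.reindex)
  then have "\<forall>w\<in>range v. l $ (inv v w) = 0"
    using ind by (auto simp: independent_explicit)
  then show ?thesis
    using inj by (simp add: vec_eq_iff)
qed

text \<open>If the product kills \<open>l\<close>, the combination of the \<open>v m\<close> with
  coefficients \<open>l\<close> is orthogonal to every \<open>w m\<close>. It then lies in both
  subspaces, so it vanishes, and independence forces \<open>l = 0\<close>.\<close>

lemma invertible_transpose_matrix_of_columns:
  fixes v w :: "'m::finite \<Rightarrow> real^'d"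
  assumes ind: "independent_family v"
    and int: "span (range v) \<inter> orthogonal_comp (span (range w)) = {0}"
  shows "invertible (transpose (matrix_of_columns w) ** matrix_of_columns v)"
proof -
  have "l = 0" if l: "(transpose (matrix_of_columns w) ** matrix_of_columns v) *v l = 0" for l
  proof -
    let ?y = "matrix_of_columns v *v l"
    have "transpose (matrix_of_columns w) *v ?y = 0"
      using l by (simp add: matrix_vector_mul_assoc)
    then have orth: "w m \<bullet> ?y = 0" for m
      using transpose_matrix_of_columns_mult_vec[of w ?y m] by simp
    have "orthogonal z ?y" if "z \<in> span (range w)" for z
      using orthogonal_to_span[OF that, of ?y] orth
      by (auto simp: orthogonal_def inner_commute)
    then have "?y \<in> orthogonal_comp (span (range w))"
      by (auto simp: orthogonal_comp_def)
    moreover have "?y \<in> span (range v)"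
      unfolding matrix_of_columns_mult_vec by (intro span_sum span_scale span_base) simp
    ultimately have "?y = 0"
      using int by blast
    with ind show ?thesis
      by (rule independent_family_matrix_of_columns_eq_0)
  qed
  then show ?thesis
    \<comment> \<open>The product is square, so a trivial kernel gives a left inverse and thereby
      invertibility.\<close>
    by (simp add: invertible_left_inverse matrix_left_invertible_ker)
qed

lemma projection_matrix_mult_vec:
  "projection_matrix A B *v y = y - A *v (matrix_inv (transpose B ** A) *v (transpose B *v y))"
  by (simp add: projection_matrix_def matrix_vector_mult_diff_rdistrib matrix_vector_mul_assoc matrix_mul_assoc
    del: transpose_matrix_vector)

text \<open>Meant for the increment \<open>y = x' - x\<close> and \<open>z = h f\<close>. The
  constraint determines the multiplier, and substituting it produces the projection; conversely
  \<open>transpose B\<close> annihilates the range of the projection.\<close>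

lemma constrained_step_iff_projected_step:
  fixes A B :: "real^'m::finite^'d"
  assumes "invertible (transpose B ** A)"
  shows "(\<exists>l. y = z + A *v l \<and> transpose B *v y = 0) \<longleftrightarrow> y = projection_matrix A B *v z"
proof -
  let ?C = "transpose B ** A"
  have inv: "matrix_inv ?C ** ?C = mat 1" "?C ** matrix_inv ?C = mat 1"
    using someI_ex[OF assms[unfolded invertible_def]] by (simp_all add: matrix_inv_def)
  show ?thesis
  proof
    assume "\<exists>l. y = z + A *v l \<and> transpose B *v y = 0"
    then obtain l where y: "y = z + A *v l" and "transpose B *v y = 0"
      by blast
    \<comment> \<open>Applying \<open>transpose B\<close> to \<open>y = z + A *v l\<close>
      eliminates \<open>y\<close>.\<close>
    then have "?C *v l = - (transpose B *v z)"
      by (simp add: matrix_vector_right_distrib matrix_vector_mul_assoc eq_neg_iff_add_eq_0 add.commute)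
    then have "l = matrix_inv ?C *v (- (transpose B *v z))"
      by (metis inv(1) matrix_vector_mul_assoc matrix_vector_mul_lid)
    then show "y = projection_matrix A B *v z"
      by (simp add: y projection_matrix_mult_vec linear_neg[OF matrix_vector_mul_linear])
  next
    assume y: "y = projection_matrix A B *v z"
    \<comment> \<open>The multiplier to be recovered is \<open>- ?u\<close>, the solution of the
      linear system found in the other direction.\<close>
    let ?u = "matrix_inv ?C *v (transpose B *v z)"
    have "transpose B *v (A *v ?u) = transpose B *v z"
      by (metis inv(2) matrix_vector_mul_assoc matrix_vector_mul_lid)
    then have "transpose B *v y = 0"
      by (simp add: y projection_matrix_mult_vec matrix_vector_mult_diff_distrib)
    moreover have "y = z + A *v (- ?u)"
      by (simp add: y projection_matrix_mult_vec linear_neg[OF matrix_vector_mul_linear])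
    ultimately show "\<exists>l. y = z + A *v l \<and> transpose B *v y = 0"
      by blast
  qed
qed

theorem theorem13:
  fixes f :: "real^'d \<Rightarrow> real^'d"
    and I :: "'m::finite \<Rightarrow> real^'d \<Rightarrow> real"
    and i :: "'m \<Rightarrow> real^'d \<Rightarrow> real^'d"
    and ft :: "real^'d \<Rightarrow> real^'d \<Rightarrow> real \<Rightarrow> real^'d"
    and it :: "'m \<Rightarrow> real^'d \<Rightarrow> real^'d \<Rightarrow> real \<Rightarrow> real^'d"
    and ib :: "'m \<Rightarrow> real^'d \<Rightarrow> real^'d \<Rightarrow> real^'d"
    and x :: "real^'d" and h0 :: real
  assumes "local_lipschitz (UNIV :: real set) UNIV (\<lambda>_. f)"
    and "\<And>m. first_integral f (I m)"
    and "\<And>m y. GDERIV (I m) y :> i m y"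
    and "consistent_approximation f ft"
    and "\<And>m. consistent_approximation (i m) (it m)"
    and "\<And>m. discrete_gradient (I m) (i m) (ib m)"
    and "0 < h0"
    and "\<And>h. 0 \<le> h \<Longrightarrow> h < h0 \<Longrightarrow> \<exists>!p. solves_a ft it I x h (fst p) (snd p)"
    and "\<And>h. 0 \<le> h \<Longrightarrow> h < h0 \<Longrightarrow> \<exists>!x'. solves_b ft it ib x h x'"
    and "\<And>h x' l. 0 \<le> h \<Longrightarrow> h < h0 \<Longrightarrow> solves_a ft it I x h x' l \<Longrightarrow> nondegenerate_at it ib x h x'"
    and "\<And>h x'. 0 \<le> h \<Longrightarrow> h < h0 \<Longrightarrow> solves_b ft it ib x h x' \<Longrightarrow> nondegenerate_at it ib x h x'"
  shows "\<forall>h. 0 \<le> h \<and> h < h0 \<longrightarrow>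
           (\<forall>x'. (\<exists>l. solves_a ft it I x h x' l) \<longleftrightarrow> solves_b ft it ib x h x')"
proof (intro allI impI)
  fix h x' assume h: "0 \<le> h \<and> h < h0"
  \<comment> \<open>Both methods are implicit in \<open>x'\<close>, but with the candidate
    \<open>x'\<close> fixed, \<open>A\<close>, \<open>B\<close> and \<open>ft x x' h\<close> are
    constants and only linear algebra remains.\<close>
  define A where "A = matrix_of_columns (\<lambda>m. it m x x' h)"
  define B where "B = matrix_of_columns (\<lambda>m. ib m x x')"
  have "ib m x x' \<bullet> (x' - x) = I m x' - I m x" for m
    using assms(6)[of m] by (simp add: discrete_gradient_def)
  then have conserved: "(\<forall>m. I m x' = I m x) \<longleftrightarrow> transpose B *v (x' - x) = 0"
    by (simp add: vec_eq_iff B_def transpose_matrix_of_columns_mult_vec del: transpose_matrix_vector)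
  have a: "(\<exists>l. solves_a ft it I x h x' l) \<longleftrightarrow>
      (\<exists>l. x' - x = h *\<^sub>R ft x x' h + A *v l \<and> transpose B *v (x' - x) = 0)"
    by (simp add: solves_a_def conserved A_def algebra_simps)
  have b: "solves_b ft it ib x h x' \<longleftrightarrow>
      invertible (transpose B ** A) \<and> x' - x = projection_matrix A B *v (h *\<^sub>R ft x x' h)"
    by (simp add: solves_b_def Let_def A_def B_def matrix_vector_mult_scaleR algebra_simps)
  \<comment> \<open>A solution of (b) carries invertibility in its definition; for a solution of (a)
    it comes from nondegeneracy at that solution.\<close>
  have "invertible (transpose B ** A)" if "solves_a ft it I x h x' l" for l
    using assms(10)[OF _ _ that] h invertible_transpose_matrix_of_columns
    by (auto simp: nondegenerate_at_def complementary_subspaces_def A_def B_def)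
  then show "(\<exists>l. solves_a ft it I x h x' l) \<longleftrightarrow> solves_b ft it ib x h x'"
    using a b constrained_step_iff_projected_step[of B A] by blast
qed

end
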